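(* Let $(L,\vee,\wedge)$ be a lattice. Then $L$ is distributive if and only if every inner derivation $d_u$ ($u\in L$) is an integral operator on $L$.
   Context: Let $(L,\vee,\wedge)$ be a lattice. For $u\in L$, the inner derivation $d_u:L\to L$ is the map $d_u(x)=x\wedge u$ for all $x\in L$. A map $P:L\to L$ is an integral operator if for all $x,y\in L$: (1) $P(x\vee y)=P(x)\vee P(y)$, and (2) $P(x)\wedge P(y)=P(P(x)\wedge y)\vee P(x\wedge P(y))$. *)

theory Defs
  imports Main
begin

definition inner_derivation :: "'a::lattice \<Rightarrow> 'a \<Rightarrow> 'a" where
  "inner_derivation u = (\<lambda>x. inf x u)"

definition integral_operator :: "('a::lattice \<Rightarrow> 'a) \<Rightarrow> bool" where
  "integral_operator P \<longleftrightarrow>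
     (\<forall>x y. P (sup x y) = sup (P x) (P y)) \<and>
     (\<forall>x y. inf (P x) (P y) = sup (P (inf (P x) y)) (P (inf x (P y))))"

end

theory Submission
  imports Defs
begin

text \<open>
  The map \<open>x \<mapsto> x \<sqinter> u\<close> satisfies the Rota--Baxter-type identity of an integral operator in
  every lattice, because both joinands on its right-hand side collapse to \<open>x \<sqinter> y \<sqinter> u\<close>. Hence
  being an integral operator amounts, for an inner derivation, to preserving binary joins
  (\<open>integral_inner_derivation_iff\<close>). Letting \<open>u\<close> range over the lattice, this is the law that
  meet distributes over join; it is equivalent to the dual law, by which the class of
  distributive lattices is axiomatised.
\<close>

lemma integral_inner_derivation_iff:
  fixes u :: "'a::lattice"
  shows "integral_operator (inner_derivation u)
         \<longleftrightarrow> (\<forall>x y. inf (sup x y) u = sup (inf x u) (inf y u))"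
proof -
  have "inf (inf x u) (inf y u) = sup (inf (inf (inf x u) y) u) (inf (inf x (inf y u)) u)"
    for x y :: 'a
    by (simp add: inf_commute inf_left_commute inf_assoc)
  then show ?thesis
    unfolding integral_operator_def inner_derivation_def by blast
qed

theorem theorem2p13:
  shows "class.distrib_lattice
           (inf :: 'a::lattice \<Rightarrow> 'a \<Rightarrow> 'a) (\<le>) (<) sup
         \<longleftrightarrow> (\<forall>u::'a. integral_operator (inner_derivation u))"
proof
  assume "class.distrib_lattice (inf :: 'a \<Rightarrow> 'a \<Rightarrow> 'a) (\<le>) (<) sup"
  then show "\<forall>u::'a. integral_operator (inner_derivation u)"
    by (simp add: integral_inner_derivation_iff distrib_lattice.inf_sup_distrib2)
next
  assume "\<forall>u::'a. integral_operator (inner_derivation u)"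
  then have "inf x (sup y z) = sup (inf x y) (inf x z)" for x y z :: 'a
    by (simp add: integral_inner_derivation_iff inf_commute)
  then have "sup x (inf y z) = inf (sup x y) (sup x z)" for x y z :: 'a
    by (rule distrib_imp1)
  then show "class.distrib_lattice (inf :: 'a \<Rightarrow> 'a \<Rightarrow> 'a) (\<le>) (<) sup"
    by unfold_locales
qed

end
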